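(* Let $\boldsymbol{\beta}=(\beta_1,\ldots,\beta_n)\in\mathbb{R}^n$, let $G$ be a random graph drawn from the probability measure $\mathbb{P}_{\boldsymbol{\beta}}$ and let $d_1,\ldots,d_n$ be the degree sequence of $G$. Let $L:=\max_{1\le i\le n}|\beta_i|$. Then there is a constant $C(L)$ depending only on $L$ such that with probability at least $1-C(L)n^{-2}$, there exists a unique solution $\hat{\boldsymbol{\beta}}=(\hat\beta_1,\ldots,\hat\beta_n)\in\mathbb{R}^n$ of the maximum likelihood equations $$d_i=\sum_{j\ne i}\frac{e^{\hat\beta_i+\hat\beta_j}}{1+e^{\hat\beta_i+\hat\beta_j}},\qquad i=1,\ldots,n,$$ and it satisfies $$\max_{1\le i\le n}|\hat\beta_i-\beta_i|\le C(L)\sqrt{\frac{\log n}{n}} .$$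
   Context: For $\boldsymbol{\beta}\in\mathbb{R}^n$, $\mathbb{P}_{\boldsymbol{\beta}}$ (the $\boldsymbol{\beta}$-model) is the law of the undirected random graph on vertices $1,\ldots,n$ in which, for each $1\le i\ne j\le n$, an edge is placed between $i$ and $j$ with probability $p_{ij}=\frac{e^{\beta_i+\beta_j}}{1+e^{\beta_i+\beta_j}}$, independently of all other edges. Here $d_i$ is the degree of vertex $i$. The constant $C(L)$ does not depend on $n$ or otherwise on $\boldsymbol{\beta}$. *)

theory Defs
  imports "HOL-Probability.Probability"
begin

text \<open>
  Since a constant uniform in \<open>n\<close> is asserted, \<open>n\<close> has to be quantified inside the formula.
  Hence \<open>\<real>\<^sup>n\<close> is rendered as the functions on \<open>{1..n}\<close>, extended by \<open>undefined\<close>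
  outside \<open>{1..n}\<close>, so that equality of functions is equality of vectors.
\<close>
definition Rvec :: "nat \<Rightarrow> (nat \<Rightarrow> real) set" where
  "Rvec n = {1..n} \<rightarrow>\<^sub>E UNIV"

definition edge_prob :: "(nat \<Rightarrow> real) \<Rightarrow> nat \<Rightarrow> nat \<Rightarrow> real" where
  "edge_prob \<beta> i j = exp (\<beta> i + \<beta> j) / (1 + exp (\<beta> i + \<beta> j))"

text \<open>
  A simple graph on the vertices \<open>1, \<dots>, n\<close> is given by its set of edges \<open>{i, j}\<close>. Each
  unordered pair is represented once, as \<open>(i, j)\<close> with \<open>i < j\<close>, and receives one
  independent coin toss.
\<close>
definition vertex_pairs :: "nat \<Rightarrow> (nat \<times> nat) set" where
  "vertex_pairs n = {(i, j). 1 \<le> i \<and> i < j \<and> j \<le> n}"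

definition beta_model :: "nat \<Rightarrow> (nat \<Rightarrow> real) \<Rightarrow> nat set set pmf" where
  "beta_model n \<beta> =
     map_pmf (\<lambda>X. {{i, j} | i j. (i, j) \<in> vertex_pairs n \<and> X (i, j)})
       (Pi_pmf (vertex_pairs n) False (\<lambda>(i, j). bernoulli_pmf (edge_prob \<beta> i j)))"

definition vertex_degree :: "nat set set \<Rightarrow> nat \<Rightarrow> nat" where
  "vertex_degree G i = card {j. j \<noteq> i \<and> {i, j} \<in> G}"

definition mle_solution :: "nat \<Rightarrow> (nat \<Rightarrow> nat) \<Rightarrow> (nat \<Rightarrow> real) \<Rightarrow> bool" where
  "mle_solution n d b \<longleftrightarrow> b \<in> Rvec n \<and>
     (\<forall>i\<in>{1..n}. real (d i) = (\<Sum>j\<in>{1..n} - {i}. exp (b i + b j) / (1 + exp (b i + b j))))"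

end

theory Submission
  imports Defs
begin

text \<open>
  Write \<open>g(b)\<close> for the vector of expected degrees under the parameter \<open>b\<close>. The likelihood
  equations read \<open>g(b) = d\<close>, while \<open>d\<close> itself is close to \<open>g(\<beta>)\<close>: each degree is a sum of
  \<open>n - 1\<close> independent coin tosses, so by Hoeffding's inequality and a union bound all
  deviations \<open>\<bar>d\<^sub>i - g\<^sub>i(\<beta>)\<bar>\<close> are at most \<open>Y = 2 \<surd>(n log n)\<close> outside an event of probability
  \<open>O(1/n\<^sup>2)\<close> (lemma \<open>all_degrees_concentrate\<close>). It remains to invert \<open>g\<close> near \<open>\<beta>\<close> and to see that
  the inverse shrinks sup-norm distances by a factor of order \<open>1/n\<close>.

  The mean value theorem gives \<open>g\<^sub>i(b) - g\<^sub>i(\<beta>) = \<Sum>\<^sub>j\<^sub>\<noteq>\<^sub>i q\<^sub>i\<^sub>j (u\<^sub>i + u\<^sub>j)\<close> for \<open>u = b - \<beta>\<close>, with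
  slopes \<open>q\<^sub>i\<^sub>j\<close> of the logistic function that lie in \<open>[\<delta>, 1]\<close> for a \<open>\<delta> > 0\<close> depending only on
  the size of \<open>b\<close> and \<open>\<beta>\<close>. Suppose \<open>\<bar>u\<^sub>i\<bar> = r\<close> is maximal, say \<open>u\<^sub>i = r\<close>. All terms of the
  \<open>i\<close>-th sum are nonnegative, so if that sum is at most \<open>Y\<close>, then \<open>r + u\<^sub>j\<close> is on average
  \<open>O(Y/n)\<close>: almost all coordinates are close to \<open>-r\<close>. But then, for the smallest coordinate \<open>u\<^sub>k\<close>,
  almost every term of the \<open>k\<close>-th sum is close to \<open>-2 r q\<^sub>k\<^sub>j\<close>, so that sum is about \<open>-2 r \<delta> n\<close> or
  less. If it is at least \<open>-Y\<close>, then \<open>r = O(Y/n)\<close>. This is lemma \<open>pair_sum_bound\<close>.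

  The bound yields uniqueness at once (take \<open>Y = 0\<close>, lemma \<open>expected_degree_inj\<close>). For existence,
  \<open>g - d\<close> is the gradient of the negative log-likelihood. A minimiser of the latter on the box
  \<open>\<bar>b\<^sub>i - \<beta>\<^sub>i\<bar> \<le> r\<close> has a partial derivative of known sign in each coordinate, and these
  signs are exactly the one-sided bounds that \<open>pair_sum_bound\<close> asks for. So if \<open>r\<close> is a large enough
  multiple of \<open>Y/n\<close>, that is, of \<open>\<surd>(log n / n)\<close>, then no coordinate is on the boundary of the box
  and the gradient vanishes (lemma \<open>expected_degree_surj_near\<close>). The minimiser is the solution,
  and it is within \<open>r\<close> of \<open>\<beta>\<close> by construction.
\<close>

section \<open>Slopes of the logistic function\<close>

definition logistic :: "real \<Rightarrow> real" where
  "logistic s = exp s / (1 + exp s)"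

lemma logistic_has_derivative:
  "(logistic has_real_derivative exp s / (1 + exp s)\<^sup>2) (at s)"
proof -
  have "1 + exp s \<noteq> 0" by (smt (verit) exp_gt_zero)
  then show ?thesis
    unfolding logistic_def [abs_def]
    by (auto intro!: derivative_eq_intros simp: power2_eq_square field_simps)
qed

lemma logistic_derivative_bounds:
  fixes s M :: real
  assumes "\<bar>s\<bar> \<le> M"
  shows "exp (- M) / 4 \<le> exp s / (1 + exp s)\<^sup>2" "exp s / (1 + exp s)\<^sup>2 \<le> 1"
proof -
  have pos: "0 < (1 + exp s)\<^sup>2" by (smt (verit) exp_gt_zero zero_less_power)
  have "(1 + exp s)\<^sup>2 = exp s * (exp s + 2 + exp (- s))"
    by (simp add: power2_eq_square algebra_simps flip: exp_add)
  also have "\<dots> \<le> exp s * (exp M + 2 * exp M + exp M)"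
    using assms by (intro mult_left_mono add_mono) auto
  finally have "(1 + exp s)\<^sup>2 * exp (- M) \<le> 4 * exp s"
    by (simp add: exp_minus field_simps)
  then show "exp (- M) / 4 \<le> exp s / (1 + exp s)\<^sup>2"
    using pos by (simp add: field_simps)
  have "exp s \<le> (1 + exp s)\<^sup>2"
    by (simp add: power2_eq_square algebra_simps add_increasing)
  then show "exp s / (1 + exp s)\<^sup>2 \<le> 1"
    using pos by (simp add: divide_le_eq)
qed

lemma logistic_slope:
  assumes "\<bar>s\<bar> \<le> M" "\<bar>t\<bar> \<le> M"
  shows "\<exists>q. exp (- M) / 4 \<le> q \<and> q \<le> 1 \<and> logistic s - logistic t = q * (s - t)"
proof -
  have less: "\<exists>q. exp (- M) / 4 \<le> q \<and> q \<le> 1 \<and> logistic s - logistic t = q * (s - t)"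
    if "\<bar>s\<bar> \<le> M" "\<bar>t\<bar> \<le> M" "t < s" for s t
  proof -
    obtain z where z: "t < z" "z < s"
      "logistic s - logistic t = (s - t) * (exp z / (1 + exp z)\<^sup>2)"
      using MVT2[OF \<open>t < s\<close> logistic_has_derivative] by blast
    have "\<bar>z\<bar> \<le> M" using z that by linarith
    from logistic_derivative_bounds[OF this] z(3) show ?thesis
      by (intro exI[of _ "exp z / (1 + exp z)\<^sup>2"]) (simp add: mult.commute)
  qed
  have refl: "exp (- M) / 4 \<le> (1::real)"
    using logistic_derivative_bounds[OF assms(1)] by linarith
  consider "t < s" | "s < t" | "s = t" by linarith
  then show ?thesis
  proof cases
    case 1 then show ?thesis using less assms by blast
  next
    case 2
    then obtain q where "exp (- M) / 4 \<le> q" "q \<le> 1" "logistic t - logistic s = q * (t - s)"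
      using less assms by blast
    then show ?thesis by (intro exI[of _ q]) (simp add: algebra_simps)
  next
    case 3 then show ?thesis using refl by (intro exI[of _ 1]) simp
  qed
qed

section \<open>A sup-norm bound for sums over pairs\<close>

text \<open>
  The two one-sided hypotheses are weaker than \<open>\<bar>\<Sum>\<^sub>k q\<^sub>j\<^sub>k (u\<^sub>j + u\<^sub>k)\<bar> \<le> Y\<close>: at the extreme values
  \<open>r\<close> and \<open>-r\<close> only one direction is demanded. This is what is known about a constrained minimiser
  on the boundary of a box. The sum at \<open>i\<close>, where \<open>u\<close> is maximal, forces most coordinates towards
  \<open>-r\<close>; the sum at the smallest coordinate then converts this into a bound on \<open>r\<close>.
\<close>

lemma pair_sum_bound_at_maximum:
  fixes u :: "'a \<Rightarrow> real" and q :: "'a \<Rightarrow> 'a \<Rightarrow> real"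
  assumes fin: "finite V" and card: "card V \<ge> 3" and "0 < \<delta>"
    and q: "\<And>j k. j \<in> V \<Longrightarrow> k \<in> V \<Longrightarrow> j \<noteq> k \<Longrightarrow> \<delta> \<le> q j k \<and> q j k \<le> 1"
    and u: "\<And>j. j \<in> V \<Longrightarrow> \<bar>u j\<bar> \<le> r"
    and lower: "\<And>j. j \<in> V \<Longrightarrow> u j < r \<Longrightarrow> - Y \<le> (\<Sum>k\<in>V - {j}. q j k * (u j + u k))"
    and upper: "\<And>j. j \<in> V \<Longrightarrow> - r < u j \<Longrightarrow> (\<Sum>k\<in>V - {j}. q j k * (u j + u k)) \<le> Y"
    and i: "i \<in> V" "u i = r" and "0 < r"
  shows "2 * r * \<delta> * (real (card V) - 2) \<le> 3 * Y / \<delta>"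
proof -
  define n where "n = real (card V)"
  define s where "s j = r + u j" for j
  define S where "S = (\<Sum>j\<in>V - {i}. s j)"
  have n: "n \<ge> 3" using card by (simp add: n_def)
  have s: "0 \<le> s j" if "j \<in> V" for j using u[OF that] by (auto simp: s_def)
  have S0: "0 \<le> S" unfolding S_def using s by (intro sum_nonneg) auto
  have cardi: "real (card (V - {i})) = n - 1"
    using fin i card by (simp add: n_def of_nat_diff)
  have "\<delta> * S = (\<Sum>j\<in>V - {i}. \<delta> * (u i + u j))"
    by (simp add: S_def s_def i sum_distrib_left)
  also have "\<dots> \<le> (\<Sum>j\<in>V - {i}. q i j * (u i + u j))"
    using q i s by (intro sum_mono mult_right_mono) (auto simp: s_def)
  also have "\<dots> \<le> Y"
    using upper i \<open>0 < r\<close> by auto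
  finally have SY: "\<delta> * S \<le> Y" .
  have Y0: "0 \<le> Y"
    using SY S0 \<open>0 < \<delta>\<close> by (meson mult_nonneg_nonneg less_imp_le order_trans)
  \<comment> \<open>Choose \<open>k\<close> with the least \<open>s k\<close>, which is then at most the average \<open>S / (n - 1)\<close>.\<close>
  have "V - {i} \<noteq> {}" using cardi n by (metis card.empty of_nat_0 diff_eq_eq add_0 numeral_le_one_iff semiring_norm(70))
  then obtain k where k: "k \<in> V - {i}" "\<And>j. j \<in> V - {i} \<Longrightarrow> s k \<le> s j"
    using fin arg_min_if_finite(1)[of "V - {i}" s] arg_min_least[of "V - {i}" _ s] by blast
  have "\<delta> \<le> 1" using q[of i k] i k by fastforce
  have sk: "(n - 1) * s k \<le> S"
    unfolding S_def cardi[symmetric] using k(2) by (intro sum_bounded_below) auto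
  have "2 * r * \<delta> * (n - 2) \<le> Y + 2 * S"
  proof (cases "u k < r")
    case True
    have "card (V - {k} - {i}) = card V - 1 - 1"
      using fin i k by (metis Diff_iff card_Diff_singleton singletonD)
    then have cardk: "real (card (V - {k} - {i})) = n - 2"
      using card by (simp add: n_def)
    \<comment> \<open>In terms of \<open>s\<close> the terms are \<open>q k j * (s k + s j - 2 * r)\<close>, except that the one for
      \<open>j = i\<close> is \<open>q k i * s k\<close>. Bounding \<open>q\<close> above by \<open>1\<close> where it multiplies \<open>s\<close> and below by \<open>\<delta>\<close>
      where it multiplies \<open>2 * r\<close> leaves \<open>n - 2\<close> copies of \<open>- 2 * r * \<delta>\<close>.\<close>
    have "- Y \<le> (\<Sum>j\<in>V - {k}. q k j * (u k + u j))"
      using lower k True by auto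
    also have "\<dots> = q k i * s k + (\<Sum>j\<in>V - {k} - {i}. q k j * (u k + u j))"
      using fin i k by (subst sum.remove[of _ i]) (auto simp: s_def algebra_simps)
    also have "\<dots> \<le> s k + (\<Sum>j\<in>V - {k} - {i}. (s k + s j) - 2 * r * \<delta>)"
    proof (intro add_mono sum_mono)
      show "q k i * s k \<le> s k"
        using q[of k i] i k s[of k] \<open>0 < \<delta>\<close> by (simp add: mult_left_le_one_le)
      fix j assume j: "j \<in> V - {k} - {i}"
      have qj: "\<delta> \<le> q k j" "q k j \<le> 1" using q[of k j] k j by auto
      have "q k j * (s k + s j) \<le> s k + s j"
        using qj \<open>0 < \<delta>\<close> s[of k] s[of j] k j by (intro mult_left_le_one_le) auto
      moreover have "\<delta> * (2 * r) \<le> q k j * (2 * r)"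
        using qj \<open>0 < r\<close> by (intro mult_right_mono) auto
      ultimately show "q k j * (u k + u j) \<le> (s k + s j) - 2 * r * \<delta>"
        by (simp add: s_def algebra_simps)
    qed
    also have "\<dots> = (n - 1) * s k + (\<Sum>j\<in>V - {k} - {i}. s j) - 2 * r * \<delta> * (n - 2)"
      by (simp add: sum.distrib sum_subtractf cardk algebra_simps)
    also have "(\<Sum>j\<in>V - {k} - {i}. s j) \<le> S"
      unfolding S_def using fin s by (intro sum_mono2) auto
    finally show ?thesis using sk by linarith
  next
    \<comment> \<open>If even the smallest coordinate equals \<open>r\<close>, there is no lower bound on its sum, but then
      the sum at \<open>i\<close> alone is large.\<close>
    case False
    then have "s k = 2 * r" using u[of k] k by (auto simp: s_def)
    then have "2 * r * (n - 1) \<le> S" using sk by (simp add: algebra_simps)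
    moreover have "2 * r * \<delta> * (n - 2) \<le> 2 * r * 1 * (n - 1)"
      using \<open>0 < r\<close> \<open>\<delta> \<le> 1\<close> \<open>0 < \<delta>\<close> n by (intro mult_mono) auto
    ultimately show ?thesis using S0 Y0 by linarith
  qed
  moreover have "S \<le> Y / \<delta>" using SY \<open>0 < \<delta>\<close> by (simp add: field_simps)
  moreover have "Y \<le> Y / \<delta>"
    using Y0 \<open>0 < \<delta>\<close> \<open>\<delta> \<le> 1\<close> by (simp add: field_simps mult_left_le)
  ultimately show ?thesis by (simp add: n_def)
qed

text \<open>
  Replacing \<open>u\<close> by \<open>-u\<close> exchanges the two one-sided hypotheses, so it is enough to treat the case
  in which the largest absolute value is attained with positive sign.
\<close>

lemma pair_sum_bound:
  fixes u :: "'a \<Rightarrow> real" and q :: "'a \<Rightarrow> 'a \<Rightarrow> real"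
  assumes fin: "finite V" and card: "card V \<ge> 3" and "0 < \<delta>"
    and q: "\<And>j k. j \<in> V \<Longrightarrow> k \<in> V \<Longrightarrow> j \<noteq> k \<Longrightarrow> \<delta> \<le> q j k \<and> q j k \<le> 1"
    and u: "\<And>j. j \<in> V \<Longrightarrow> \<bar>u j\<bar> \<le> r"
    and lower: "\<And>j. j \<in> V \<Longrightarrow> u j < r \<Longrightarrow> - Y \<le> (\<Sum>k\<in>V - {j}. q j k * (u j + u k))"
    and upper: "\<And>j. j \<in> V \<Longrightarrow> - r < u j \<Longrightarrow> (\<Sum>k\<in>V - {j}. q j k * (u j + u k)) \<le> Y"
    and i: "i \<in> V" "\<bar>u i\<bar> = r" and "0 < r"
  shows "2 * r * \<delta> * (real (card V) - 2) \<le> 3 * Y / \<delta>"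
proof (cases "u i = r")
  case True
  show ?thesis
    by (rule pair_sum_bound_at_maximum[of V \<delta> q u r Y i]) (use assms True in auto)
next
  case False
  then have ui: "- u i = r" using i by auto
  have neg: "(\<Sum>k\<in>V - {j}. q j k * (- u j + - u k)) = - (\<Sum>k\<in>V - {j}. q j k * (u j + u k))" for j
    by (simp add: sum_negf[symmetric] algebra_simps)
  show ?thesis
  proof (rule pair_sum_bound_at_maximum[of V \<delta> q "\<lambda>j. - u j" r Y i])
    show "- Y \<le> (\<Sum>k\<in>V - {j}. q j k * (- u j + - u k))" if "j \<in> V" "- u j < r" for j
      unfolding neg using upper[of j] that by auto
    show "(\<Sum>k\<in>V - {j}. q j k * (- u j + - u k)) \<le> Y" if "j \<in> V" "- r < - u j" for j
      unfolding neg using lower[of j] that by auto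
  qed (use assms ui in auto)
qed

section \<open>Expected degrees determine the parameters\<close>

definition expected_degree :: "'a set \<Rightarrow> ('a \<Rightarrow> real) \<Rightarrow> 'a \<Rightarrow> real" where
  "expected_degree V b i = (\<Sum>j\<in>V - {i}. logistic (b i + b j))"

text \<open>
  By the mean value theorem, the difference of two expected degrees is a sum over pairs as above,
  with weights that depend on both parameters but stay in a fixed interval.
\<close>

lemma expected_degree_bound:
  fixes b b' :: "'a \<Rightarrow> real"
  assumes fin: "finite V" and card: "card V \<ge> 3"
    and b: "\<And>j. j \<in> V \<Longrightarrow> 2 * \<bar>b j\<bar> \<le> M" and b': "\<And>j. j \<in> V \<Longrightarrow> 2 * \<bar>b' j\<bar> \<le> M"
    and dist: "\<And>j. j \<in> V \<Longrightarrow> \<bar>b j - b' j\<bar> \<le> r"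
    and lower: "\<And>j. j \<in> V \<Longrightarrow> b j - b' j < r \<Longrightarrow>
      - Y \<le> expected_degree V b j - expected_degree V b' j"
    and upper: "\<And>j. j \<in> V \<Longrightarrow> - r < b j - b' j \<Longrightarrow>
      expected_degree V b j - expected_degree V b' j \<le> Y"
    and i: "i \<in> V" "\<bar>b i - b' i\<bar> = r" and "0 < r" and \<delta>: "\<delta> = exp (- M) / 4"
  shows "2 * r * \<delta> * (real (card V) - 2) \<le> 3 * Y / \<delta>"
proof -
  have "\<exists>x. \<delta> \<le> x \<and> x \<le> 1 \<and> logistic (b j + b k) - logistic (b' j + b' k)
      = x * ((b j + b k) - (b' j + b' k))" if "j \<in> V" "k \<in> V" for j k
    unfolding \<delta> using b[OF that(1)] b[OF that(2)] b'[OF that(1)] b'[OF that(2)]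
    by (intro logistic_slope) auto
  then obtain q where q: "\<And>j k. j \<in> V \<Longrightarrow> k \<in> V \<Longrightarrow> \<delta> \<le> q j k \<and> q j k \<le> 1 \<and>
      logistic (b j + b k) - logistic (b' j + b' k) = q j k * ((b j + b k) - (b' j + b' k))"
    by metis
  have diff: "expected_degree V b j - expected_degree V b' j
      = (\<Sum>k\<in>V - {j}. q j k * ((b j - b' j) + (b k - b' k)))" if "j \<in> V" for j
    unfolding expected_degree_def sum_subtractf[symmetric] add_diff_add[symmetric]
    using q that by (intro sum.cong) auto
  show ?thesis
  proof (rule pair_sum_bound[of V \<delta> q "\<lambda>j. b j - b' j" r Y i])
    show "- Y \<le> (\<Sum>k\<in>V - {j}. q j k * ((b j - b' j) + (b k - b' k)))"
      if "j \<in> V" "b j - b' j < r" for j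
      using lower[OF that] diff[OF that(1)] by simp
    show "(\<Sum>k\<in>V - {j}. q j k * ((b j - b' j) + (b k - b' k))) \<le> Y"
      if "j \<in> V" "- r < b j - b' j" for j
      using upper[OF that] diff[OF that(1)] by simp
    show "0 < \<delta>" by (simp add: \<delta>)
  qed (use assms q in auto)
qed

text \<open>
  If the expected degrees agree, the previous bound applies with \<open>Y = 0\<close> and \<open>r\<close> the distance of the
  parameters. With only two vertices this fails, since the expected degrees depend on \<open>b\<^sub>1 + b\<^sub>2\<close>
  alone.
\<close>

lemma expected_degree_inj:
  fixes b b' :: "'a \<Rightarrow> real"
  assumes fin: "finite V" and card: "card V \<ge> 3"
    and eq: "\<And>j. j \<in> V \<Longrightarrow> expected_degree V b j = expected_degree V b' j"
    and "i \<in> V"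
  shows "b i = b' i"
proof (rule ccontr)
  assume "b i \<noteq> b' i"
  define r where "r = (MAX j\<in>V. \<bar>b j - b' j\<bar>)"
  define M where "M = (MAX j\<in>V. 2 * \<bar>b j\<bar> + 2 * \<bar>b' j\<bar>)"
  have r: "\<bar>b j - b' j\<bar> \<le> r" if "j \<in> V" for j
    unfolding r_def using fin that by (intro Max_ge) auto
  have M: "2 * \<bar>b j\<bar> + 2 * \<bar>b' j\<bar> \<le> M" if "j \<in> V" for j
    unfolding M_def using fin that by (intro Max_ge) auto
  have "r \<in> (\<lambda>j. \<bar>b j - b' j\<bar>) ` V"
    unfolding r_def using fin \<open>i \<in> V\<close> by (intro Max_in) auto
  then obtain k where k: "k \<in> V" "\<bar>b k - b' k\<bar> = r" by auto
  have "0 < r" using r[OF \<open>i \<in> V\<close>] \<open>b i \<noteq> b' i\<close> by linarith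
  have "2 * r * (exp (- M) / 4) * (real (card V) - 2) \<le> 3 * 0 / (exp (- M) / 4)"
  proof (rule expected_degree_bound[of V b M b' r 0 k])
    show "2 * \<bar>b j\<bar> \<le> M" "2 * \<bar>b' j\<bar> \<le> M" if "j \<in> V" for j
      using M[OF that] by linarith+
  qed (use fin card r k eq \<open>0 < r\<close> in auto)
  moreover have "0 < 2 * r * (exp (- M) / 4) * (real (card V) - 2)"
    using \<open>0 < r\<close> card by (intro mult_pos_pos) auto
  ultimately show False by simp
qed

section \<open>Solving the likelihood equations near a given parameter\<close>

text \<open>
  The probability of a graph with degrees \<open>d\<close> is the exponential of minus this value: the
  normalising factor has one term for each unordered pair, which is half the sum over ordered pairs.
  Ordered pairs avoid an order on the vertices.
\<close>

definition neg_log_likelihood :: "'a set \<Rightarrow> ('a \<Rightarrow> real) \<Rightarrow> ('a \<Rightarrow> real) \<Rightarrow> real" where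
  "neg_log_likelihood V d b =
     (\<Sum>i\<in>V. \<Sum>j\<in>V - {i}. ln (1 + exp (b i + b j))) / 2 - (\<Sum>i\<in>V. d i * b i)"

lemma continuous_on_neg_log_likelihood:
  "continuous_on S (neg_log_likelihood V d)"
proof -
  have [continuous_intros]: "continuous_on S (\<lambda>b. b i)" for i :: 'a and S :: "('a \<Rightarrow> real) set"
    by (rule continuous_on_subset[OF continuous_on_product_coordinates]) auto
  have "1 + exp x \<noteq> (0::real)" for x by (smt (verit) exp_gt_zero)
  then show ?thesis
    unfolding neg_log_likelihood_def [abs_def] by (intro continuous_intros) auto
qed

lemma neg_log_likelihood_partial_derivative:
  fixes b :: "'a \<Rightarrow> real"
  assumes fin: "finite V" and i: "i \<in> V"
  shows "((\<lambda>t. neg_log_likelihood V d (b(i := t))) has_real_derivative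
           expected_degree V b i - d i) (at (b i))"
proof -
  define e :: "'a \<Rightarrow> real" where "e j = (if j = i then 1 else 0)" for j
  have coord: "((\<lambda>t. (b(i := t)) j) has_real_derivative e j) (at (b i))" for j
    by (cases "j = i") (auto simp: e_def)
  have pair: "((\<lambda>t. ln (1 + exp ((b(i := t)) j + (b(i := t)) k))) has_real_derivative
      logistic (b j + b k) * (e j + e k)) (at (b i))" for j k
  proof -
    have pos: "0 < 1 + exp x" for x :: real by (smt (verit) exp_gt_zero)
    have "((\<lambda>t. (b(i := t)) j + (b(i := t)) k) has_real_derivative e j + e k) (at (b i))"
      by (intro DERIV_add coord)
    from DERIV_add[OF DERIV_const[of 1] DERIV_fun_exp[OF this]]
    have "((\<lambda>t. 1 + exp ((b(i := t)) j + (b(i := t)) k)) has_real_derivative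
        exp (b j + b k) * (e j + e k)) (at (b i))"
      by (simp del: fun_upd_apply)
    from DERIV_chain2[OF DERIV_ln_divide this] pos show ?thesis
      by (simp add: logistic_def del: fun_upd_apply)
  qed
  have "((\<lambda>t. neg_log_likelihood V d (b(i := t))) has_real_derivative
      (\<Sum>j\<in>V. \<Sum>k\<in>V - {j}. logistic (b j + b k) * (e j + e k)) / 2 - (\<Sum>j\<in>V. d j * e j)) (at (b i))"
    unfolding neg_log_likelihood_def
    by (intro DERIV_diff DERIV_cdivide DERIV_sum DERIV_cmult pair coord)
  moreover have "(\<Sum>j\<in>V. d j * e j) = d i"
    using fin i by (simp add: e_def if_distrib sum.delta cong: if_cong)
  moreover have "(\<Sum>j\<in>V. \<Sum>k\<in>V - {j}. logistic (b j + b k) * (e j + e k)) = 2 * expected_degree V b i"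
  proof -
    have row: "(\<Sum>k\<in>V - {j}. logistic (b j + b k) * e j) = (if j = i then expected_degree V b i else 0)" for j
      by (auto simp: e_def expected_degree_def)
    have col: "(\<Sum>k\<in>V - {j}. logistic (b j + b k) * e k) = (if j = i then 0 else logistic (b i + b j))" 
      if "j \<in> V" for j
      using fin i by (auto simp: e_def if_distrib sum.delta add.commute cong: if_cong)
    have "(\<Sum>j\<in>V. \<Sum>k\<in>V - {j}. logistic (b j + b k) * (e j + e k))
        = (\<Sum>j\<in>V. if j = i then expected_degree V b i else 0)
        + (\<Sum>j\<in>V. if j = i then 0 else logistic (b i + b j))"
      by (simp add: distrib_left sum.distrib row col)
    also have "(\<Sum>j\<in>V. if j = i then 0 else logistic (b i + b j)) = expected_degree V b i"
      unfolding expected_degree_def using fin i by (subst sum.remove[of _ i]) auto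
    finally show ?thesis using fin i by simp
  qed
  ultimately show ?thesis by simp
qed

text \<open>
  The solution is a minimiser of the negative log-likelihood on the box of radius \<open>r\<close> around \<open>\<beta>\<close>.
  At a minimiser, the partial derivative is nonnegative in each coordinate that can be increased
  and nonpositive in each coordinate that can be decreased. If some coordinate were on the boundary,
  the sup-norm bound would contradict the assumed size of \<open>r\<close>.
\<close>

lemma expected_degree_surj_near:
  fixes \<beta> d :: "'a \<Rightarrow> real"
  assumes fin: "finite V" and card: "card V \<ge> 3" and "0 < r"
    and M: "\<And>i. i \<in> V \<Longrightarrow> 2 * \<bar>\<beta> i\<bar> + 2 * r \<le> M" and \<delta>: "\<delta> = exp (- M) / 4"
    and Y: "\<And>i. i \<in> V \<Longrightarrow> \<bar>d i - expected_degree V \<beta> i\<bar> \<le> Y"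
    and big: "3 * Y / \<delta> < 2 * r * \<delta> * (real (card V) - 2)"
  obtains b where "b \<in> V \<rightarrow>\<^sub>E UNIV" "\<And>i. i \<in> V \<Longrightarrow> expected_degree V b i = d i"
    "\<And>i. i \<in> V \<Longrightarrow> \<bar>b i - \<beta> i\<bar> \<le> r"
proof -
  \<comment> \<open>Fixing the coordinates outside \<open>V\<close> makes the box compact in the product topology.\<close>
  define I where "I i = (if i \<in> V then {\<beta> i - r..\<beta> i + r} else {undefined})" for i
  define K where "K = Pi\<^sub>E UNIV I"
  have "compactin (product_topology (\<lambda>i. euclidean) UNIV) K"
    unfolding K_def compactin_PiE by (auto simp: I_def)
  then have "compact K" by (simp add: euclidean_product_topology)
  moreover have "\<beta>' \<in> K" if "\<beta>' = (\<lambda>i. if i \<in> V then \<beta> i else undefined)" for \<beta>'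
    using that \<open>0 < r\<close> by (auto simp: K_def I_def)
  ultimately obtain b where b: "b \<in> K" and
    min: "\<And>x. x \<in> K \<Longrightarrow> neg_log_likelihood V d b \<le> neg_log_likelihood V d x"
    using continuous_attains_inf[of K "neg_log_likelihood V d"] continuous_on_neg_log_likelihood
    by blast
  have dist: "\<bar>b i - \<beta> i\<bar> \<le> r" if "i \<in> V" for i
    using PiE_mem[OF b[unfolded K_def], of i] that by (auto simp: I_def abs_le_iff)
  have ext: "b \<in> V \<rightarrow>\<^sub>E UNIV"
  proof (rule PiE_I)
    show "b i = undefined" if "i \<notin> V" for i
      using PiE_mem[OF b[unfolded K_def], of i] that by (simp add: I_def)
  qed simp
  have upd: "b(i := t) \<in> K" if "i \<in> V" "\<bar>t - \<beta> i\<bar> \<le> r" for i t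
    unfolding K_def
  proof (rule PiE_I)
    show "(b(i := t)) j \<in> I j" for j
      using PiE_mem[OF b[unfolded K_def], of j] that
      by (cases "j = i") (auto simp: I_def abs_le_iff)
  qed simp
  \<comment> \<open>Both signs hold by minimality: otherwise a small step inside the box would lower the value.\<close>
  have right: "0 \<le> expected_degree V b i - d i" if i: "i \<in> V" and "b i - \<beta> i < r" for i
  proof (rule ccontr)
    assume "\<not> ?thesis"
    then obtain h0 where "h0 > 0" and h0: "\<And>h. h > 0 \<Longrightarrow> h < h0 \<Longrightarrow>
        neg_log_likelihood V d (b(i := b i + h)) < neg_log_likelihood V d (b(i := b i))"
      using DERIV_neg_dec_right[OF neg_log_likelihood_partial_derivative[OF fin i, of d b]] by auto
    define h where "h = min (h0 / 2) (r - (b i - \<beta> i))"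
    have h: "h > 0" "h < h0" "h \<le> r - (b i - \<beta> i)"
      using \<open>h0 > 0\<close> that by (auto simp: h_def)
    have "b(i := b i + h) \<in> K"
      by (rule upd[OF i]) (use dist[OF i] h in linarith)
    with h0[of h] h min show False by force
  qed
  have left: "expected_degree V b i - d i \<le> 0" if i: "i \<in> V" and "- r < b i - \<beta> i" for i
  proof (rule ccontr)
    assume "\<not> ?thesis"
    then obtain h0 where "h0 > 0" and h0: "\<And>h. h > 0 \<Longrightarrow> h < h0 \<Longrightarrow>
        neg_log_likelihood V d (b(i := b i - h)) < neg_log_likelihood V d (b(i := b i))"
      using DERIV_pos_inc_left[OF neg_log_likelihood_partial_derivative[OF fin i, of d b]] by auto
    define h where "h = min (h0 / 2) (r + (b i - \<beta> i))"
    have h: "h > 0" "h < h0" "h \<le> r + (b i - \<beta> i)"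
      using \<open>h0 > 0\<close> that by (auto simp: h_def)
    have "b(i := b i - h) \<in> K"
      by (rule upd[OF i]) (use dist[OF i] h in linarith)
    with h0[of h] h min show False by force
  qed
  have interior: "\<bar>b i - \<beta> i\<bar> < r" if "i \<in> V" for i
  proof (rule ccontr)
    assume "\<not> ?thesis"
    then have "\<bar>b i - \<beta> i\<bar> = r" using dist[OF that] by simp
    have "2 * r * \<delta> * (real (card V) - 2) \<le> 3 * Y / \<delta>"
    proof (rule expected_degree_bound[of V b M \<beta> r Y i])
      show "- Y \<le> expected_degree V b j - expected_degree V \<beta> j" if "j \<in> V" "b j - \<beta> j < r" for j
        using right[OF that] Y[OF that(1)] by linarith
      show "expected_degree V b j - expected_degree V \<beta> j \<le> Y" if "j \<in> V" "- r < b j - \<beta> j" for j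
        using left[OF that] Y[OF that(1)] by linarith
      show "2 * \<bar>b j\<bar> \<le> M" if "j \<in> V" for j
        using dist[OF that] M[OF that] by linarith
      show "2 * \<bar>\<beta> j\<bar> \<le> M" if "j \<in> V" for j
        using M[OF that] \<open>0 < r\<close> by linarith
    qed (use fin card that dist \<open>\<bar>b i - \<beta> i\<bar> = r\<close> \<open>0 < r\<close> \<delta> in auto)
    then show False using big by simp
  qed
  show thesis
  proof (rule that[OF ext])
    show "expected_degree V b i = d i" if "i \<in> V" for i
      using right[OF that] left[OF that] interior[OF that] by (simp add: abs_less_iff)
  qed (use dist in auto)
qed

section \<open>Concentration of the degrees\<close>

lemma finite_vertex_pairs: "finite (vertex_pairs n)"
  by (rule finite_subset[of _ "{1..n} \<times> {1..n}"]) (auto simp: vertex_pairs_def)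

definition incident_pairs :: "nat \<Rightarrow> nat \<Rightarrow> (nat \<times> nat) set" where
  "incident_pairs n i = {e \<in> vertex_pairs n. fst e = i \<or> snd e = i}"

lemma sum_incident_pairs:
  assumes "i \<in> {1..n}"
  shows "(\<Sum>e\<in>incident_pairs n i. h e) = (\<Sum>j\<in>{1..n} - {i}. h (min i j, max i j))"
  using assms
  by (intro sum.reindex_bij_witness[of _ "\<lambda>j. (min i j, max i j)" "\<lambda>e. if fst e = i then snd e else fst e"])
    (auto simp: incident_pairs_def vertex_pairs_def min_def max_def split: if_splits)

definition graph_of_tosses :: "nat \<Rightarrow> (nat \<times> nat \<Rightarrow> bool) \<Rightarrow> nat set set" where
  "graph_of_tosses n X = {{i, j} | i j. (i, j) \<in> vertex_pairs n \<and> X (i, j)}"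

lemma vertex_degree_graph_of_tosses:
  assumes "i \<in> {1..n}"
  shows "real (vertex_degree (graph_of_tosses n X) i) = (\<Sum>e\<in>incident_pairs n i. of_bool (X e))"
proof -
  have "{j. j \<noteq> i \<and> {i, j} \<in> graph_of_tosses n X} = {j \<in> {1..n} - {i}. X (min i j, max i j)}"
    using assms
    by (auto simp: graph_of_tosses_def vertex_pairs_def doubleton_eq_iff min_def max_def
        split: if_splits) (metis linorder_neqE_nat nat_less_le not_le)+
  then show ?thesis
    by (simp add: vertex_degree_def sum_incident_pairs[OF assms] of_bool_def sum.If_cases Int_def
        del: of_bool_eq_iff)
qed

lemma edge_prob_bounds: "0 \<le> edge_prob \<beta> i j" "edge_prob \<beta> i j \<le> 1"
  by (auto simp: edge_prob_def add_pos_pos)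

lemma edge_prob_eq_logistic: "edge_prob \<beta> i j = logistic (\<beta> i + \<beta> j)"
  by (simp add: edge_prob_def logistic_def)

text \<open>
  The degree of \<open>i\<close> is the sum of the independent tosses for the pairs that contain \<open>i\<close>, and its mean
  is the expected degree, so Hoeffding's inequality for \<open>[0, 1]\<close>-valued variables applies.
\<close>

lemma degree_tail_bound:
  assumes i: "i \<in> {1..n}" and "n \<ge> 2" and "0 \<le> \<epsilon>"
  shows "measure_pmf.prob (beta_model n \<beta>)
      {G. \<epsilon> \<le> \<bar>real (vertex_degree G i) - expected_degree {1..n} \<beta> i\<bar>}
    \<le> 2 * exp (- 2 * \<epsilon>\<^sup>2 / real n)"
proof -
  define P where "P = Pi_pmf (vertex_pairs n) False (\<lambda>(i, j). bernoulli_pmf (edge_prob \<beta> i j))"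
  define E where "E = incident_pairs n i"
  have E: "E \<subseteq> vertex_pairs n" by (auto simp: E_def incident_pairs_def)
  have expect: "measure_pmf.expectation P (\<lambda>X. of_bool (X e)) = edge_prob \<beta> (fst e) (snd e)"
    if "e \<in> E" for e
  proof -
    have "measure_pmf.expectation P (\<lambda>X. of_bool (X e))
        = measure_pmf.expectation (map_pmf (\<lambda>X. X e) P) (of_bool :: bool \<Rightarrow> real)"
      by simp
    also have "map_pmf (\<lambda>X. X e) P = bernoulli_pmf (edge_prob \<beta> (fst e) (snd e))"
      using that E finite_vertex_pairs by (auto simp: P_def Pi_pmf_component case_prod_beta)
    finally show ?thesis by (simp add: edge_prob_bounds)
  qed
  have total: "(\<Sum>e\<in>E. measure_pmf.expectation P (\<lambda>X. of_bool (X e))) = expected_degree {1..n} \<beta> i"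
  proof -
    have "(\<Sum>e\<in>E. measure_pmf.expectation P (\<lambda>X. of_bool (X e)))
        = (\<Sum>e\<in>E. logistic (\<beta> (fst e) + \<beta> (snd e)))"
      by (simp add: expect edge_prob_eq_logistic)
    also have "\<dots> = (\<Sum>j\<in>{1..n} - {i}. logistic (\<beta> (min i j) + \<beta> (max i j)))"
      unfolding E_def by (simp add: sum_incident_pairs[OF i])
    also have "\<dots> = expected_degree {1..n} \<beta> i"
      unfolding expected_degree_def by (intro sum.cong) (auto simp: min_def max_def add.commute)
    finally show ?thesis .
  qed
  have "(\<Sum>e\<in>E. 1 :: real) = (\<Sum>j\<in>{1..n} - {i}. 1)"
    unfolding E_def by (rule sum_incident_pairs[OF i])
  then have cardE: "real (card E) = real n - 1"
    using i by (simp add: of_nat_diff)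
  interpret Hoeffding_ineq "measure_pmf P" E "\<lambda>e X. of_bool (X e)" "\<lambda>_. 0" "\<lambda>_. 1"
    "expected_degree {1..n} \<beta> i"
  proof unfold_locales
    show "finite E" using E finite_vertex_pairs finite_subset by blast
    have "prob_space.indep_vars (measure_pmf P) (\<lambda>_. count_space UNIV) (\<lambda>e X. X e) E"
      unfolding P_def
      by (rule prob_space.indep_vars_subset[OF _ indep_vars_Pi_pmf E])
        (auto simp: measure_pmf.prob_space_axioms finite_vertex_pairs)
    then show "prob_space.indep_vars (measure_pmf P) (\<lambda>_. borel) (\<lambda>e X. of_bool (X e) :: real) E"
      by (rule prob_space.indep_vars_compose2[OF measure_pmf.prob_space_axioms]) auto
  qed (use total in auto)
  have "measure_pmf.prob (beta_model n \<beta>)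
      {G. \<epsilon> \<le> \<bar>real (vertex_degree G i) - expected_degree {1..n} \<beta> i\<bar>}
    = measure_pmf.prob P {X. \<epsilon> \<le> \<bar>(\<Sum>e\<in>E. of_bool (X e)) - expected_degree {1..n} \<beta> i\<bar>}"
    by (simp add: beta_model_def measure_map_pmf vimage_def E_def P_def
        vertex_degree_graph_of_tosses[OF i] flip: graph_of_tosses_def)
  also have "\<dots> \<le> 2 * exp (- 2 * \<epsilon>\<^sup>2 / real (card E))"
    using Hoeffding_ineq_abs_ge[OF \<open>0 \<le> \<epsilon>\<close>] cardE \<open>n \<ge> 2\<close> by simp
  also have "\<dots> \<le> 2 * exp (- 2 * \<epsilon>\<^sup>2 / real n)"
    using cardE \<open>n \<ge> 2\<close> by (simp add: divide_left_mono)
  finally show ?thesis .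
qed

text \<open>
  The deviation is chosen such that Hoeffding's bound becomes \<open>2/n\<^sup>8\<close>; for the sum over the \<open>n\<close>
  vertices to be \<open>2/n\<^sup>2\<close> it suffices that each tail is at most \<open>2/n\<^sup>3\<close>.
\<close>

lemma all_degrees_concentrate:
  assumes "n \<ge> 2"
  shows "measure_pmf.prob (beta_model n \<beta>)
      {G. \<forall>i\<in>{1..n}. \<bar>real (vertex_degree G i) - expected_degree {1..n} \<beta> i\<bar>
            \<le> 2 * sqrt (real n * ln (real n))}
    \<ge> 1 - 2 / real n ^ 2"
proof -
  define \<epsilon> where "\<epsilon> = 2 * sqrt (real n * ln (real n))"
  define bad where "bad i = {G. \<epsilon> \<le> \<bar>real (vertex_degree G i) - expected_degree {1..n} \<beta> i\<bar>}" for i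
  have n: "real n \<ge> 2" using assms by simp
  have ln: "0 \<le> ln (real n)" using n by simp
  have "exp (- 2 * \<epsilon>\<^sup>2 / real n) = exp (- (ln (real n) * 8))"
    using n ln by (simp add: \<epsilon>_def power_mult_distrib field_simps)
  also have "\<dots> = 1 / real n ^ 8"
    using n by (simp add: exp_minus exp_of_nat2_mult[of _ 8, simplified] inverse_eq_divide)
  also have "\<dots> \<le> 1 / real n ^ 3"
    using n by (intro divide_left_mono power_increasing) auto
  finally have tail: "exp (- 2 * \<epsilon>\<^sup>2 / real n) \<le> 1 / real n ^ 3" .
  have "measure_pmf.prob (beta_model n \<beta>) (\<Union>i\<in>{1..n}. bad i)
      \<le> (\<Sum>i\<in>{1..n}. measure_pmf.prob (beta_model n \<beta>) (bad i))"
    by (intro measure_pmf.finite_measure_subadditive_finite) auto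
  also have "\<dots> \<le> (\<Sum>i\<in>{1..n}. 2 * (1 / real n ^ 3))"
  proof (rule sum_mono)
    fix i assume "i \<in> {1..n}"
    from degree_tail_bound[OF this assms, of \<epsilon> \<beta>] tail ln n
    show "measure_pmf.prob (beta_model n \<beta>) (bad i) \<le> 2 * (1 / real n ^ 3)"
      by (simp add: bad_def \<epsilon>_def)
  qed
  also have "\<dots> = 2 / real n ^ 2"
    using n by (simp add: power2_eq_square power3_eq_cube)
  finally have "1 - 2 / real n ^ 2 \<le> measure_pmf.prob (beta_model n \<beta>) (- (\<Union>i\<in>{1..n}. bad i))"
    using measure_pmf.prob_compl[of "\<Union>i\<in>{1..n}. bad i" "beta_model n \<beta>"]
    by (simp add: Compl_eq_Diff_UNIV)
  also have "\<dots> \<le> measure_pmf.prob (beta_model n \<beta>)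
      {G. \<forall>i\<in>{1..n}. \<bar>real (vertex_degree G i) - expected_degree {1..n} \<beta> i\<bar> \<le> \<epsilon>}"
    by (intro measure_pmf.finite_measure_mono) (force simp: bad_def)+
  finally show ?thesis by (simp add: \<epsilon>_def)
qed

section \<open>The maximum likelihood estimate\<close>

lemma mle_solution_iff_expected_degree:
  "mle_solution n d b \<longleftrightarrow>
     b \<in> Rvec n \<and> (\<forall>i\<in>{1..n}. expected_degree {1..n} b i = real (d i))"
  by (auto simp: mle_solution_def expected_degree_def logistic_def)

text \<open>
  The box has radius \<open>r = A \<surd>(log n / n)\<close>. Largeness of \<open>n\<close> gives \<open>r \<le> 1\<close>, so all
  sums \<open>b\<^sub>i + b\<^sub>j\<close> in the box are at most \<open>2 L + 2\<close> in absolute value and \<open>\<delta>\<close> bounds the logistic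
  slopes from below. Since \<open>n - 2 \<ge> n/3\<close>, the radius is large enough as soon as
  \<open>A > 9/\<delta>\<^sup>2\<close>.
\<close>

lemma mle_near_parameter:
  assumes n: "n \<ge> 3" and L: "\<And>i. i \<in> {1..n} \<Longrightarrow> \<bar>\<beta> i\<bar> \<le> L"
    and \<delta>: "\<delta> = exp (- (2 * L + 2)) / 4" and A: "A = 10 / \<delta>\<^sup>2"
    and large: "A\<^sup>2 * ln (real n) \<le> real n"
    and d: "\<And>i. i \<in> {1..n} \<Longrightarrow>
      \<bar>real (d i) - expected_degree {1..n} \<beta> i\<bar> \<le> 2 * sqrt (real n * ln (real n))"
  shows "\<exists>b. mle_solution n d b \<and> (\<forall>b'. mle_solution n d b' \<longrightarrow> b' = b) \<and>
    (\<forall>i\<in>{1..n}. \<bar>b i - \<beta> i\<bar> \<le> A * sqrt (ln (real n) / real n))"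
proof -
  define r where "r = A * sqrt (ln (real n) / real n)"
  have \<delta>0: "0 < \<delta>" by (simp add: \<delta>)
  have A0: "0 < A" using \<delta>0 by (simp add: A)
  have ln: "0 < ln (real n)" using n by simp
  have r0: "0 < r" using A0 ln n by (simp add: r_def)
  have "r\<^sup>2 \<le> 1"
    using large ln n by (simp add: r_def power_mult_distrib field_simps)
  then have r1: "r \<le> 1" by (simp add: power_le_one_iff abs_square_le_1 r0 less_imp_le)
  have rn: "r * real n = A * sqrt (real n * ln (real n))"
  proof -
    have "real n = sqrt (real n) * sqrt (real n)" by simp
    then show ?thesis
      using n by (simp add: r_def real_sqrt_mult real_sqrt_divide field_simps)
  qed
  have sq: "0 < sqrt (real n * ln (real n))" using ln n by simp
  have "3 * (2 * sqrt (real n * ln (real n))) / \<delta>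
      < 2 / 3 * \<delta> * (A * sqrt (real n * ln (real n)))"
    using sq \<delta>0 by (simp add: A power2_eq_square field_simps)
  also have "\<dots> = 2 * r * \<delta> * (real n / 3)"
    by (simp add: rn[symmetric])
  also have "\<dots> \<le> 2 * r * \<delta> * (real n - 2)"
    using r0 \<delta>0 n by (intro mult_left_mono) auto
  finally have big: "3 * (2 * sqrt (real n * ln (real n))) / \<delta> < 2 * r * \<delta> * (real (card {1..n}) - 2)"
    by simp
  obtain b where b: "b \<in> {1..n} \<rightarrow>\<^sub>E UNIV"
    "\<And>i. i \<in> {1..n} \<Longrightarrow> expected_degree {1..n} b i = real (d i)"
    "\<And>i. i \<in> {1..n} \<Longrightarrow> \<bar>b i - \<beta> i\<bar> \<le> r"
  proof (rule expected_degree_surj_near[of "{1..n}" r \<beta> "2 * L + 2" \<delta> "\<lambda>i. real (d i)"])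
    show "2 * \<bar>\<beta> i\<bar> + 2 * r \<le> 2 * L + 2" if "i \<in> {1..n}" for i
      using L[OF that] r1 by simp
  qed (use n r0 \<delta> d big in auto)
  have mle: "mle_solution n d b"
    using b by (simp add: mle_solution_iff_expected_degree Rvec_def)
  moreover have "b' = b" if b': "mle_solution n d b'" for b'
  proof (rule PiE_ext)
    show "b' \<in> {1..n} \<rightarrow>\<^sub>E UNIV" "b \<in> {1..n} \<rightarrow>\<^sub>E UNIV"
      using b' b by (auto simp: mle_solution_def Rvec_def)
    show "b' i = b i" if "i \<in> {1..n}" for i
      by (rule expected_degree_inj[of "{1..n}"])
        (use that b' mle n in \<open>auto simp: mle_solution_iff_expected_degree\<close>)
  qed
  ultimately show ?thesis using b(3) unfolding r_def by blast
qed

lemma ln_le_two_sqrt: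
  assumes "0 < x"
  shows "ln x \<le> 2 * sqrt x"
  using ln_less_self[of "sqrt x"] assms by (simp add: ln_sqrt)

text \<open>
  The logarithm is negligible against \<open>n\<close>: where the requirement \<open>A\<^sup>2 log n \<le> n\<close> on the size of \<open>n\<close>
  fails, the bound \<open>log n \<le> 2 \<surd>n\<close> gives \<open>n\<^sup>2 < 16 A\<^sup>8\<close>. Taking \<open>C = 16 A\<^sup>8\<close> makes the asserted
  probability bound nonpositive for those \<open>n\<close>, and also for \<open>n \<le> 2\<close>, where the solution is not unique
  or does not exist.
\<close>

theorem theorem1p3:
  shows "\<exists>C :: real \<Rightarrow> real. \<forall>n\<ge>1. \<forall>\<beta>\<in>Rvec n. \<forall>L. L = (MAX i\<in>{1..n}. \<bar>\<beta> i\<bar>) \<longrightarrow>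
    measure_pmf.prob (beta_model n \<beta>)
      {G. \<exists>b. mle_solution n (vertex_degree G) b \<and>
              (\<forall>b'. mle_solution n (vertex_degree G) b' \<longrightarrow> b' = b) \<and>
              (MAX i\<in>{1..n}. \<bar>b i - \<beta> i\<bar>) \<le> C L * sqrt (ln (real n) / real n)}
    \<ge> 1 - C L / real n ^ 2"
proof -
  define \<delta> :: "real \<Rightarrow> real" where "\<delta> L = exp (- (2 * L + 2)) / 4" for L
  define A where "A L = 10 / (\<delta> L)\<^sup>2" for L
  define C where "C L = 16 * A L ^ 8" for L
  have main: "1 - C L / real n ^ 2 \<le> measure_pmf.prob (beta_model n \<beta>)
      {G. \<exists>b. mle_solution n (vertex_degree G) b \<and>
              (\<forall>b'. mle_solution n (vertex_degree G) b' \<longrightarrow> b' = b) \<and>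
              (MAX i\<in>{1..n}. \<bar>b i - \<beta> i\<bar>) \<le> C L * sqrt (ln (real n) / real n)}"
    (is "_ \<le> measure_pmf.prob _ ?good")
    if n: "n \<ge> 1" and L: "L = (MAX i\<in>{1..n}. \<bar>\<beta> i\<bar>)" for n \<beta> L
  proof -
    have L_ge: "\<bar>\<beta> i\<bar> \<le> L" if "i \<in> {1..n}" for i
      unfolding L using that by (intro Max_ge) auto
    have "0 \<le> L" using L_ge[of 1] n by auto
    then have "exp (- (2 * L + 2)) \<le> 1" by (subst exp_le_one_iff) simp
    then have "\<delta> L \<le> 1" unfolding \<delta>_def by linarith
    have "0 < \<delta> L" by (simp add: \<delta>_def)
    then have A: "10 \<le> A L" 
      using power_le_one[of "\<delta> L" 2] \<open>\<delta> L \<le> 1\<close> by (simp add: A_def field_simps)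
    have CA: "A L \<le> C L"
      using A self_le_power[of "A L" 8] by (simp add: C_def)
    show ?thesis
    proof (cases "n \<ge> 3 \<and> (A L)\<^sup>2 * ln (real n) \<le> real n")
      case True
      have "1 - C L / real n ^ 2 \<le> 1 - 2 / real n ^ 2"
        using A CA n by (simp add: divide_right_mono)
      also have "\<dots> \<le> measure_pmf.prob (beta_model n \<beta>)
          {G. \<forall>i\<in>{1..n}. \<bar>real (vertex_degree G i) - expected_degree {1..n} \<beta> i\<bar>
            \<le> 2 * sqrt (real n * ln (real n))}"
        using True by (intro all_degrees_concentrate) auto
      also have "\<dots> \<le> measure_pmf.prob (beta_model n \<beta>) ?good"
      proof (intro measure_pmf.finite_measure_mono subsetI CollectI, goal_cases)
        case (1 G)
        then have d: "\<bar>real (vertex_degree G i) - expected_degree {1..n} \<beta> i\<bar>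
            \<le> 2 * sqrt (real n * ln (real n))" if "i \<in> {1..n}" for i
          using that by blast
        obtain b where b: "mle_solution n (vertex_degree G) b"
          "\<forall>b'. mle_solution n (vertex_degree G) b' \<longrightarrow> b' = b"
          "\<forall>i\<in>{1..n}. \<bar>b i - \<beta> i\<bar> \<le> A L * sqrt (ln (real n) / real n)"
          using mle_near_parameter
              [OF conjunct1[OF True] L_ge \<delta>_def A_def conjunct2[OF True] d] by blast
        have "(MAX i\<in>{1..n}. \<bar>b i - \<beta> i\<bar>) \<le> A L * sqrt (ln (real n) / real n)"
          using b(3) n by (subst Max_le_iff) auto
        also have "\<dots> \<le> C L * sqrt (ln (real n) / real n)"
          using CA n by (intro mult_right_mono) auto
        finally show ?case using b by blast
      qed auto
      finally show ?thesis .
    next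
      case False
      have "(real n)\<^sup>2 \<le> C L"
      proof (cases "n \<ge> 3")
        case True
        have "sqrt (real n) * sqrt (real n) < (A L)\<^sup>2 * ln (real n)"
          using False True by auto
        also have "\<dots> \<le> (A L)\<^sup>2 * (2 * sqrt (real n))"
          using n by (intro mult_left_mono ln_le_two_sqrt) auto
        finally have "sqrt (real n) * sqrt (real n) < 2 * (A L)\<^sup>2 * sqrt (real n)"
          by (simp add: mult_ac)
        then have "sqrt (real n) < 2 * (A L)\<^sup>2"
          by (rule mult_right_less_imp_less) simp
        then have "sqrt (real n) ^ 4 \<le> (2 * (A L)\<^sup>2) ^ 4"
          by (intro power_mono) auto
        also have "sqrt (real n) ^ 4 = (real n)\<^sup>2"
          using power_mult[of "sqrt (real n)" 2 2] by simp
        finally show ?thesis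
          by (simp add: C_def power_mult_distrib flip: power_mult)
      next
        case False
        then have "(real n)\<^sup>2 \<le> 2\<^sup>2" by (intro power_mono) auto
        then show ?thesis using A CA by simp
      qed
      then have "1 - C L / real n ^ 2 \<le> 0" using n by (simp add: field_simps)
      then show ?thesis by (rule order_trans) simp
    qed
  qed
  then show ?thesis by (intro exI[of _ C]) blast
qed

end
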